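(* Let $\tau$ be a topology on $\mathbb{R}$ such that (i) $\tau_e\subset\tau$, and (ii) every nonempty $\tau$-open set has the Baire property and is non-meager (with respect to the Euclidean topology). Then the class of pointwise limits of sequences of $\tau$-Świątkowski functions equals $\mathfrak{S}$.
   Context: $\tau_e$ is the Euclidean topology on $\mathbb{R}$. For a topology $\tau$ and $f\colon\mathbb{R}\to\mathbb{R}$, $\mathrm{C}_\tau(f)$ is the set of points at which $f\colon(\mathbb{R},\tau)\to(\mathbb{R},\tau_e)$ is continuous. $f$ is a $\tau$-Świątkowski function if for all $a,b\in\mathbb{R}$ with $f(a)<f(b)$ there exists $x\in\mathrm{C}_\tau(f)$ strictly between $a$ and $b$ with $f(a)<f(x)<f(b)$. A function has the Baire property if preimages of open sets are of the form $O\triangle M$ with $O$ open and $M$ meager; a set is residual if its complement is meager. For $a,b\in\mathbb{R}$, $I(a,b)$ is the open interval with end-points $a,b$. For $A\subset\mathbb{R}$, an interval $J$ and $\varepsilon\ge0$, $f$ satisfies $S(J,A,\varepsilon)$ if for all $a,b\in J$ with $f(a)<f(b)$ there exists $x\in A\cap I(a,b)$ with $f(x)\in(f(a)-\varepsilon,f(b)+\varepsilon)$. $f$ satisfies $S(A,\varepsilon)$ if the union of all open intervals $J$ for which $S(J,A,\varepsilon)$ holds is dense in $\mathbb{R}$. $\mathfrak{S}$ is the class of functions with the Baire property satisfying $S(A,\varepsilon)$ for all residual $A\subset\mathbb{R}$ and all $\varepsilon>0$. *)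

theory Defs
  imports "HOL-Analysis.Analysis"
begin

definition nowhere_dense :: "real set \<Rightarrow> bool" where
  "nowhere_dense A \<longleftrightarrow> interior (closure A) = {}"

definition meager :: "real set \<Rightarrow> bool" where
  "meager A \<longleftrightarrow> (\<exists>N :: nat \<Rightarrow> real set. (\<forall>n. nowhere_dense (N n)) \<and> A \<subseteq> (\<Union>n. N n))"

definition residual :: "real set \<Rightarrow> bool" where
  "residual A \<longleftrightarrow> meager (- A)"

definition baire_set :: "real set \<Rightarrow> bool" where
  "baire_set A \<longleftrightarrow> (\<exists>U M. open U \<and> meager M \<and> A = (U - M) \<union> (M - U))"

definition baire_fun :: "(real \<Rightarrow> real) \<Rightarrow> bool" where
  "baire_fun f \<longleftrightarrow> (\<forall>V. open V \<longrightarrow> baire_set (f -` V))"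

definition Iab :: "real \<Rightarrow> real \<Rightarrow> real set" where
  "Iab a b = {min a b <..< max a b}"

definition cont_pts :: "real topology \<Rightarrow> (real \<Rightarrow> real) \<Rightarrow> real set" where
  "cont_pts T f = {x. \<forall>e>0. \<exists>U. openin T U \<and> x \<in> U \<and> (\<forall>y\<in>U. \<bar>f y - f x\<bar> < e)}"

definition swiat :: "real topology \<Rightarrow> (real \<Rightarrow> real) \<Rightarrow> bool" where
  "swiat T f \<longleftrightarrow> (\<forall>a b. f a < f b \<longrightarrow>
      (\<exists>x \<in> cont_pts T f. x \<in> Iab a b \<and> f a < f x \<and> f x < f b))"

definition S_int :: "real set \<Rightarrow> real set \<Rightarrow> real \<Rightarrow> (real \<Rightarrow> real) \<Rightarrow> bool" where
  "S_int J A e f \<longleftrightarrow> (\<forall>a\<in>J. \<forall>b\<in>J. f a < f b \<longrightarrow>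
      (\<exists>x \<in> A \<inter> Iab a b. f a - e < f x \<and> f x < f b + e))"

definition S_prop :: "real set \<Rightarrow> real \<Rightarrow> (real \<Rightarrow> real) \<Rightarrow> bool" where
  "S_prop A e f \<longleftrightarrow>
     closure (\<Union>{J. (\<exists>c d. J = {c<..<d}) \<and> S_int J A e f}) = UNIV"

definition frakS :: "(real \<Rightarrow> real) set" where
  "frakS = {f. baire_fun f \<and> (\<forall>A. residual A \<longrightarrow> (\<forall>e>0. S_prop A e f))}"

end

(*
  Limits are in the class: a function that is Swiatkowski for T is T-continuous on a residual set,
  hence has the Baire property. If f_n -> f, then by the Baire category theorem |f_n - f| <= e/4 holds
  for all large n on a residual part of some subinterval of any given interval. For a, b there with
  f(a) < f(b), take a T-continuity point of f_n between them with value in (f_n(a), f_n(b)): a T-open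
  neighbourhood of it is non-meager, so it meets that residual part intersected with A.

  Conversely, a function f in the class is a limit of functions that are Swiatkowski already for the
  Euclidean topology. Let f be continuous on the residual set A, the complement of the union of the
  closed nowhere dense sets M_i. For each m there is a closed nowhere dense F_m such that on every
  interval missing F_m the condition S holds and f oscillates on A by little, so that all values of f
  on A between a and b are 1/(m+1)-close to the interval between f(a) and f(b). Let K_n be the union
  of F_i and M_i (i <= n) and a grid of mesh 1/(n+1). Put f_n = f on K_n; on a component C of the
  complement of K_n, let f_n oscillate infinitely often near both ends of C over an open interval
  centred at a value of f on A in C. The radius is 1/m for the least m such that C comes
  1/(n+1)-close to F_m (m = n+1 if there is no such m <= n): it tends to 0 at points outside
  all F_m, and it is large where S gives no control.
*)
theory Submission
  imports Defs
begin

section \<open>Meager sets and the Baire property\<close>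

lemma nowhere_dense_Un:
  assumes "nowhere_dense A" "nowhere_dense B"
  shows "nowhere_dense (A \<union> B)"
  using assms unfolding nowhere_dense_def closure_Un
  by (simp add: interior_closed_Un_empty_interior)

lemma nowhere_dense_imp_meager: "nowhere_dense A \<Longrightarrow> meager A"
  unfolding meager_def by (rule exI[of _ "\<lambda>_. A"]) auto

lemma meager_mono: "meager B \<Longrightarrow> A \<subseteq> B \<Longrightarrow> meager A"
  unfolding meager_def by (meson order_trans)

lemma meager_UN:
  fixes A :: "nat \<Rightarrow> real set"
  assumes "\<And>i. meager (A i)"
  shows "meager (\<Union>i. A i)"
proof -
  have "\<forall>i. \<exists>N. (\<forall>n. nowhere_dense (N n)) \<and> A i \<subseteq> (\<Union>n::nat. N n)"
    using assms unfolding meager_def by blast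
  then obtain N :: "nat \<Rightarrow> nat \<Rightarrow> real set"
    where "\<forall>i. (\<forall>n. nowhere_dense (N i n)) \<and> A i \<subseteq> (\<Union>n. N i n)"
    by (rule choice[THEN exE])
  then have N: "\<And>i n. nowhere_dense (N i n)" "\<And>i. A i \<subseteq> (\<Union>n. N i n)" by blast+
  let ?N = "\<lambda>k. N (fst (prod_decode k)) (snd (prod_decode k))"
  have "A i \<subseteq> (\<Union>k. ?N k)" for i
  proof
    fix x assume "x \<in> A i"
    then obtain n where "x \<in> N i n" using N(2) by blast
    then have "x \<in> ?N (prod_encode (i, n))" by simp
    then show "x \<in> (\<Union>k. ?N k)" by blast
  qed
  then show ?thesis
    unfolding meager_def using N(1) by (intro exI[of _ ?N]) auto
qed

lemma meager_Un:
  assumes "meager A" "meager B"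
  shows "meager (A \<union> B)"
proof -
  have "meager (\<Union>i::nat. if i = 0 then A else B)"
    by (rule meager_UN) (use assms in auto)
  moreover have "A \<union> B \<subseteq> (\<Union>i::nat. if i = 0 then A else B)"
    by (auto split: if_splits intro: exI[of _ "0::nat"] exI[of _ "1::nat"])
  ultimately show ?thesis by (rule meager_mono)
qed

text \<open>Passing to closures keeps the sets nowhere dense, and closed sets have the open
  complements that Baire's theorem requires.\<close>

lemma meager_closed_cover:
  assumes "meager A"
  obtains N :: "nat \<Rightarrow> real set"
  where "\<And>n. closed (N n)" "\<And>n. nowhere_dense (N n)" "A \<subseteq> (\<Union>n. N n)"
proof -
  obtain N :: "nat \<Rightarrow> real set" where "\<forall>n. nowhere_dense (N n)" "A \<subseteq> (\<Union>n. N n)"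
    using assms unfolding meager_def by blast
  then show thesis
    by (intro that[of "\<lambda>n. closure (N n)"])
      (auto simp: nowhere_dense_def dest!: subsetD intro: closure_subset[THEN subsetD])
qed

lemma closure_compl_UN_nowhere_dense:
  fixes N :: "nat \<Rightarrow> real set"
  assumes "\<And>n. closed (N n)" "\<And>n. nowhere_dense (N n)"
  shows "closure (- (\<Union>n. N n)) = UNIV"
proof -
  have "UNIV \<subseteq> closure (\<Inter>(range (\<lambda>n. - N n)))"
  proof (rule Baire)
    fix T assume "T \<in> range (\<lambda>n. - N n)"
    then obtain n where T: "T = - N n" by blast
    have "closure (- N n) = UNIV"
      using assms unfolding nowhere_dense_def by (simp add: closure_complement)
    then show "openin (top_of_set UNIV) T \<and> UNIV \<subseteq> closure T"
      using T assms(1) by auto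
  qed auto
  moreover have "\<Inter>(range (\<lambda>n. - N n)) = - (\<Union>n. N n)" by auto
  ultimately have "UNIV \<subseteq> closure (- (\<Union>n. N n))" by (simp only:)
  then show ?thesis by (rule top.extremum_uniqueI)
qed

lemma open_not_meager:
  assumes "open W" "W \<noteq> {}"
  shows "\<not> meager W"
proof
  assume "meager W"
  then obtain N :: "nat \<Rightarrow> real set"
    where N: "\<And>n. closed (N n)" "\<And>n. nowhere_dense (N n)" "W \<subseteq> (\<Union>n. N n)"
    by (rule meager_closed_cover) blast
  have "W \<inter> closure (- (\<Union>n. N n)) \<noteq> {}"
    using closure_compl_UN_nowhere_dense[OF N(1,2)] assms by auto
  then have "W \<inter> - (\<Union>n. N n) \<noteq> {}"
    using assms(1) by (simp add: open_Int_closure_eq_empty)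
  then show False using N(3) by blast
qed

text \<open>Splitting the symmetric difference into its two halves lets each be estimated separately
  by monotonicity of meagerness.\<close>

lemma baire_set_iff:
  "baire_set A \<longleftrightarrow> (\<exists>U. open U \<and> meager (A - U) \<and> meager (U - A))"
proof
  assume "baire_set A"
  then obtain U M where U: "open U" "meager M" "A = (U - M) \<union> (M - U)"
    unfolding baire_set_def by blast
  then have "A - U \<subseteq> M" "U - A \<subseteq> M" by auto
  then show "\<exists>U. open U \<and> meager (A - U) \<and> meager (U - A)"
    using U meager_mono by blast
next
  assume "\<exists>U. open U \<and> meager (A - U) \<and> meager (U - A)"
  then obtain U where "open U" "meager (A - U)" "meager (U - A)" by blast
  then have "open U \<and> meager ((A - U) \<union> (U - A)) \<and>
      A = (U - ((A - U) \<union> (U - A))) \<union> (((A - U) \<union> (U - A)) - U)"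
    using meager_Un by blast
  then show "baire_set A" unfolding baire_set_def by blast
qed

lemma meager_empty [simp]: "meager {}"
  by (rule nowhere_dense_imp_meager) (simp add: nowhere_dense_def)

text \<open>The open set for the complement is the exterior \<open>- closure U\<close>. It differs
  from \<open>- U\<close> only by the boundary of \<open>U\<close>, which is nowhere dense because
  \<open>U\<close> is open.\<close>

lemma baire_set_Compl:
  assumes "baire_set A"
  shows "baire_set (- A)"
proof -
  obtain U where U: "open U" "meager (A - U)" "meager (U - A)"
    using assms baire_set_iff by blast
  have "interior (closure U - U) = {}"
  proof -
    have "interior (closure U - U) \<inter> U = {}" using interior_subset by blast
    then have "interior (closure U - U) \<inter> closure U = {}"
      by (simp add: open_Int_closure_eq_empty)
    then show ?thesis using interior_subset by blast
  qed
  then have "nowhere_dense (closure U - U)"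
    using U(1) unfolding nowhere_dense_def by (simp add: closed_Diff)
  then have "meager ((U - A) \<union> (closure U - U))"
    using U(3) by (simp add: meager_Un nowhere_dense_imp_meager)
  then have "meager (- A - - closure U)" by (rule meager_mono) auto
  moreover have "- closure U - - A \<subseteq> A - U" using closure_subset by blast
  then have "meager (- closure U - - A)" using U(2) meager_mono by blast
  ultimately show ?thesis
    unfolding baire_set_iff by (intro exI[of _ "- closure U"]) auto
qed

lemma baire_set_UN:
  fixes A :: "nat \<Rightarrow> real set"
  assumes "\<And>i. baire_set (A i)"
  shows "baire_set (\<Union>i. A i)"
proof -
  obtain U where U: "\<And>i. open (U i)" "\<And>i. meager (A i - U i)" "\<And>i. meager (U i - A i)"
    using assms unfolding baire_set_iff by metis
  have "meager ((\<Union>i. A i) - (\<Union>i. U i))"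
    by (rule meager_mono[OF meager_UN[of "\<lambda>i. A i - U i", OF U(2)]]) blast
  moreover have "meager ((\<Union>i. U i) - (\<Union>i. A i))"
    by (rule meager_mono[OF meager_UN[of "\<lambda>i. U i - A i", OF U(3)]]) blast
  ultimately show ?thesis
    unfolding baire_set_iff using U(1) by (intro exI[of _ "\<Union>i. U i"]) auto
qed

lemma baire_set_open: "open U \<Longrightarrow> baire_set U"
  unfolding baire_set_iff by (intro exI[of _ U]) auto

text \<open>Only the sigma-algebra matters here. Presenting it as a measure space turns the Baire
  property of functions into Borel measurability, so the library results on limits and on
  measurability of defined sets apply.\<close>

definition baire_algebra :: "real measure" where
  "baire_algebra = sigma UNIV {A. baire_set A}"

lemma space_baire_algebra [simp]: "space baire_algebra = UNIV"
  by (simp add: baire_algebra_def space_measure_of_conv)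

lemma sets_baire_algebra [simp]: "sets baire_algebra = {A. baire_set A}"
proof -
  have "sigma_algebra UNIV {A. baire_set A}"
    unfolding sigma_algebra_iff2
  proof (intro conjI ballI allI impI)
    show "{} \<in> {A. baire_set A}" using baire_set_open[of "{}"] by simp
    show "UNIV - A \<in> {A. baire_set A}" if "A \<in> {A. baire_set A}" for A
      using baire_set_Compl that unfolding Compl_eq_Diff_UNIV by simp
    show "\<Union>(range A) \<in> {A. baire_set A}" if "range A \<subseteq> {A. baire_set A}" for A :: "nat \<Rightarrow> real set"
      using baire_set_UN[of A] that by auto
  qed simp
  then show ?thesis
    unfolding baire_algebra_def by (rule sigma_algebra.sets_measure_of_eq)
qed

lemma baire_fun_iff_measurable: "baire_fun f \<longleftrightarrow> f \<in> borel_measurable baire_algebra"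
proof
  assume "baire_fun f"
  then show "f \<in> borel_measurable baire_algebra"
    by (intro borel_measurableI) (auto simp: baire_fun_def)
next
  assume f: "f \<in> borel_measurable baire_algebra"
  show "baire_fun f"
    unfolding baire_fun_def using measurable_sets[OF f borel_open] by auto
qed

lemma baire_fun_lim:
  assumes "\<And>n. baire_fun (fs n)" "\<And>x. (\<lambda>n. fs n x) \<longlonglongrightarrow> f x"
  shows "baire_fun f"
  using assms borel_measurable_LIMSEQ_real[of baire_algebra fs f]
  unfolding baire_fun_iff_measurable by blast

lemma baire_set_modulo_meager:
  assumes "baire_set B" "meager (A - B)" "meager (B - A)"
  shows "baire_set A"
proof -
  obtain U where U: "open U" "meager (B - U)" "meager (U - B)"
    using assms(1) baire_set_iff by blast
  have "meager (A - U)"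
    using meager_Un[OF assms(2) U(2)] by (rule meager_mono) auto
  moreover have "meager (U - A)"
    using meager_Un[OF assms(3) U(3)] by (rule meager_mono) auto
  ultimately show ?thesis using U(1) baire_set_iff by blast
qed

lemma residual_Inter:
  fixes A :: "nat \<Rightarrow> real set"
  shows "(\<And>n. residual (A n)) \<Longrightarrow> residual (\<Inter>n. A n)"
  unfolding residual_def by (simp add: meager_UN)

lemma residual_dense:
  assumes "residual A" "open W" "W \<noteq> {}"
  shows "\<exists>x\<in>A. x \<in> W"
proof (rule ccontr)
  assume "\<not> ?thesis"
  then have "W \<subseteq> - A" by blast
  then show False using assms open_not_meager meager_mono residual_def by metis
qed

section \<open>Limits of Swiatkowski functions\<close>

locale baire_refinement =
  fixes T :: "real topology"
  assumes open_imp_openin: "open U \<Longrightarrow> openin T U"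
    and openin_baire: "openin T U \<Longrightarrow> U \<noteq> {} \<Longrightarrow> baire_set U"
    and openin_not_meager: "openin T U \<Longrightarrow> U \<noteq> {} \<Longrightarrow> \<not> meager U"
begin

text \<open>Let \<open>V\<close> be a Euclidean open set equal to \<open>U\<close> up to meager
  sets. If \<open>V\<close> missed a nonempty open set, the part of \<open>U\<close> there would be
  nonempty and open for \<open>T\<close>, yet contained in the meager set \<open>U - V\<close>. So
  \<open>V\<close> is dense, and \<open>- V\<close> is nowhere dense.\<close>

lemma openin_dense_residual:
  assumes U: "openin T U" and dense: "\<And>W. open W \<Longrightarrow> W \<noteq> {} \<Longrightarrow> U \<inter> W \<noteq> {}"
  shows "residual U"
proof -
  have "U \<noteq> {}" using dense[of UNIV] by auto
  then obtain V where V: "open V" "meager (U - V)" "meager (V - U)"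
    using openin_baire[OF U] baire_set_iff by blast
  have "- closure V = {}"
  proof (rule ccontr)
    assume *: "- closure V \<noteq> {}"
    have "openin T (U \<inter> - closure V)"
      using U open_imp_openin[of "- closure V"] by (simp add: openin_Int open_Compl)
    then have "\<not> meager (U \<inter> - closure V)"
      using openin_not_meager dense[OF _ *] by (simp add: open_Compl)
    moreover have "U \<inter> - closure V \<subseteq> U - V" using closure_subset by blast
    ultimately show False using V(2) meager_mono by blast
  qed
  then have "nowhere_dense (- V)"
    using V(1) unfolding nowhere_dense_def
    by (simp add: interior_complement closed_Compl closure_closed)
  then have "meager (- V \<union> (V - U))"
    using V(3) by (simp add: meager_Un nowhere_dense_imp_meager)
  then show ?thesis unfolding residual_def by (rule meager_mono) auto
qed

text \<open>On a ball where \<open>g\<close> takes two values the Swiatkowski condition supplies a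
  continuity point between them; on a ball where \<open>g\<close> is constant the centre is
  one.\<close>

lemma swiat_cont_pts_dense:
  assumes g: "swiat T g" and W: "open W" "W \<noteq> {}"
  shows "cont_pts T g \<inter> W \<noteq> {}"
proof -
  obtain x e where x: "e > 0" "ball x e \<subseteq> W"
    using W open_contains_ball by (metis all_not_in_conv)
  show ?thesis
  proof (cases "\<exists>a\<in>ball x e. \<exists>b\<in>ball x e. g a < g b")
    case True
    then obtain a b where ab: "a \<in> ball x e" "b \<in> ball x e" "g a < g b" by blast
    then obtain y where "y \<in> cont_pts T g" "y \<in> Iab a b"
      using g unfolding swiat_def by blast
    moreover have "Iab a b \<subseteq> ball x e"
      using ab unfolding Iab_def by (auto simp: dist_real_def min_def max_def split: if_splits)
    ultimately show ?thesis using x by blast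
  next
    case False
    then have "g y = g x" if "y \<in> ball x e" for y
      using that x(1) by (metis centre_in_ball linorder_neqE_linordered_idom)
    then have "\<forall>y\<in>ball x e. \<bar>g y - g x\<bar> < e'" if "e' > 0" for e' using that by simp
    moreover have "openin T (ball x e)" "x \<in> ball x e" using open_imp_openin x(1) by auto
    ultimately have "x \<in> cont_pts T g" unfolding cont_pts_def by blast
    then show ?thesis using \<open>x \<in> ball x e\<close> x(2) by blast
  qed
qed

lemma residual_cont_pts:
  assumes g: "swiat T g"
  shows "residual (cont_pts T g)"
proof -
  \<comment> \<open>These are the sets of points with a \<open>T\<close>-neighbourhood on which
    \<open>g\<close> oscillates by less than \<open>e\<close>. Each is open for \<open>T\<close>
    and, as it contains the dense set of continuity points, residual. Their intersection over a null
    sequence of \<open>e\<close> lies in \<open>cont_pts T g\<close>.\<close>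
  define O' where "O' e = \<Union>{U. openin T U \<and> (\<forall>y\<in>U. \<forall>z\<in>U. \<bar>g y - g z\<bar> < e)}" for e
  have sub: "cont_pts T g \<subseteq> O' e" if e: "e > 0" for e
  proof
    fix x assume "x \<in> cont_pts T g"
    then obtain U where U: "openin T U" "x \<in> U" "\<forall>y\<in>U. \<bar>g y - g x\<bar> < e / 2"
      using half_gt_zero[OF e] unfolding cont_pts_def by blast
    have "\<bar>g y - g z\<bar> < e" if "y \<in> U" "z \<in> U" for y z
    proof -
      have "\<bar>g y - g x\<bar> < e / 2" "\<bar>g z - g x\<bar> < e / 2" using U(3) that by blast+
      then show ?thesis unfolding abs_less_iff by argo
    qed
    then show "x \<in> O' e" using U unfolding O'_def by blast
  qed
  have "residual (O' (1 / (real n + 1)))" for n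
  proof (rule openin_dense_residual)
    show "openin T (O' (1 / (real n + 1)))" unfolding O'_def by (rule openin_Union) auto
    show "O' (1 / (real n + 1)) \<inter> W \<noteq> {}" if "open W" "W \<noteq> {}" for W
      using swiat_cont_pts_dense[OF g that] sub[of "1 / (real n + 1)"] by force
  qed
  then have "residual (\<Inter>n::nat. O' (1 / (real n + 1)))" by (rule residual_Inter)
  moreover have "(\<Inter>n::nat. O' (1 / (real n + 1))) \<subseteq> cont_pts T g"
  proof
    fix x assume x: "x \<in> (\<Inter>n::nat. O' (1 / (real n + 1)))"
    show "x \<in> cont_pts T g"
      unfolding cont_pts_def
    proof (rule CollectI, intro allI impI)
      fix e :: real assume "e > 0"
      then obtain n :: nat where n: "1 / (real n + 1) < e"
        using reals_Archimedean[of e] by (auto simp: inverse_eq_divide add.commute)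
      from x have "x \<in> O' (1 / (real n + 1))" by blast
      then obtain U where "openin T U" "x \<in> U" "\<forall>y\<in>U. \<forall>z\<in>U. \<bar>g y - g z\<bar> < 1 / (real n + 1)"
        unfolding O'_def by blast
      then show "\<exists>U. openin T U \<and> x \<in> U \<and> (\<forall>y\<in>U. \<bar>g y - g x\<bar> < e)"
        using n by (blast intro: order_less_trans)
    qed
  qed
  ultimately show ?thesis
    unfolding residual_def using meager_mono Compl_anti_mono by blast
qed

lemma swiat_imp_baire_fun:
  assumes g: "swiat T g"
  shows "baire_fun g"
  unfolding baire_fun_def
proof (intro allI impI)
  fix V :: "real set" assume V: "open V"
  \<comment> \<open>\<open>W\<close> is the \<open>T\<close>-interior of the preimage; the points of
    the preimage outside it are points of \<open>T\<close>-discontinuity, which form a meager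
    set.\<close>
  define W where "W = \<Union>{U. openin T U \<and> U \<subseteq> g -` V}"
  have "openin T W" unfolding W_def by (rule openin_Union) auto
  then have "baire_set W" using openin_baire baire_set_open by (cases "W = {}") auto
  moreover have "g -` V - W \<subseteq> - cont_pts T g"
  proof
    fix x assume x: "x \<in> g -` V - W"
    show "x \<in> - cont_pts T g"
    proof
      assume c: "x \<in> cont_pts T g"
      obtain e where e: "e > 0" "\<And>y. \<bar>y - g x\<bar> < e \<Longrightarrow> y \<in> V"
        using V x unfolding open_dist dist_real_def by auto
      then obtain U where "openin T U" "x \<in> U" "\<forall>y\<in>U. \<bar>g y - g x\<bar> < e"
        using c unfolding cont_pts_def by blast
      then have "x \<in> W" unfolding W_def using e(2) by blast
      then show False using x by blast
    qed
  qed
  then have "meager (g -` V - W)"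
    using residual_cont_pts[OF g] meager_mono unfolding residual_def by blast
  moreover have "W - g -` V = {}" unfolding W_def by blast
  ultimately show "baire_set (g -` V)" using baire_set_modulo_meager[of W "g -` V"] meager_empty by metis
qed

lemma swiat_lim_S_prop:
  assumes sw: "\<And>n. swiat T (fs n)" and lim: "\<And>x. (\<lambda>n. fs n x) \<longlonglongrightarrow> f x"
    and A: "residual A" and e: "e > 0"
  shows "S_prop A e f"
proof -
  \<comment> \<open>By pointwise convergence these sets cover the line, so one of them is non-meager
    in any given nonempty open set.\<close>
  define E where "E N = (\<Inter>n\<in>{N..}. {x. \<bar>fs n x - f x\<bar> \<le> e / 4})" for N
  have meas: "fs n \<in> borel_measurable baire_algebra" "f \<in> borel_measurable baire_algebra" for n
    using swiat_imp_baire_fun[OF sw] baire_fun_lim[OF _ lim] baire_fun_iff_measurable by auto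
  have "E N \<in> sets baire_algebra" for N
  proof -
    have "{x \<in> space baire_algebra. \<forall>n\<in>{N..}. \<bar>fs n x - f x\<bar> \<le> e / 4} \<in> sets baire_algebra"
      using meas by measurable
    moreover have "E N = {x \<in> space baire_algebra. \<forall>n\<in>{N..}. \<bar>fs n x - f x\<bar> \<le> e / 4}"
      unfolding E_def by auto
    ultimately show ?thesis by simp
  qed
  then have baire_E: "baire_set (E N)" for N by simp
  have cover: "(\<Union>N. E N) = UNIV"
  proof -
    have "\<exists>N. x \<in> E N" for x
    proof -
      obtain N where "\<forall>n\<ge>N. norm (fs n x - f x) < e / 4"
        using LIMSEQ_D[OF lim, of "e / 4"] e by auto
      then show ?thesis unfolding E_def by (intro exI[of _ N]) (auto intro: less_imp_le)
    qed
    then show ?thesis by blast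
  qed
  let ?G = "\<Union>{J. (\<exists>c d. J = {c<..<d}) \<and> S_int J A e f}"
  have "closure ?G = UNIV"
  proof (rule ccontr)
    assume "closure ?G \<noteq> UNIV"
    then have W: "open (- closure ?G)" "- closure ?G \<noteq> {}" by auto
    define W where "W = - closure ?G"
    have "\<exists>N. \<not> meager (W \<inter> E N)"
    proof (rule ccontr)
      assume "\<not> ?thesis"
      then have "meager (\<Union>N. W \<inter> E N)" by (intro meager_UN) blast
      moreover have "(\<Union>N. W \<inter> E N) = W" using cover by blast
      ultimately show False using open_not_meager W W_def by simp
    qed
    then obtain N where N: "\<not> meager (W \<inter> E N)" by blast
    \<comment> \<open>Inside \<open>U\<close> all points outside a meager set belong to
      \<open>E N\<close>, and \<open>U\<close> meets \<open>W\<close> because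
      \<open>W \<inter> E N\<close> is non-meager.\<close>
    obtain U where U: "open U" "meager (E N - U)" "meager (U - E N)"
      using baire_E[of N] baire_set_iff by blast
    have "W \<inter> U \<noteq> {}"
    proof
      assume "W \<inter> U = {}"
      then have "W \<inter> E N \<subseteq> E N - U" by blast
      then show False using N U(2) meager_mono by blast
    qed
    moreover have "open (W \<inter> U)" using W U W_def by auto
    ultimately obtain p r where pr: "r > 0" "ball p r \<subseteq> W \<inter> U"
      using open_contains_ball by (metis all_not_in_conv)
    have "S_int (ball p r) A e f"
      unfolding S_int_def
    proof (intro ballI impI)
      fix a b assume ab: "a \<in> ball p r" "b \<in> ball p r" "f a < f b"
      \<comment> \<open>A quarter of the gap preserves the order of the values at \<open>a\<close>
        and \<open>b\<close> when \<open>f\<close> is replaced by \<open>fs n\<close>. The bound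
        \<open>e / 4\<close> is used in the final estimate, where it adds to the error
        \<open>e / 4\<close> on \<open>E N\<close>.\<close>
      define \<delta> where "\<delta> = min (e / 4) ((f b - f a) / 4)"
      have \<delta>: "\<delta> > 0" using e ab by (simp add: \<delta>_def)
      obtain n1 where n1: "\<forall>n\<ge>n1. norm (fs n a - f a) < \<delta>" using LIMSEQ_D[OF lim \<delta>] by blast
      obtain n2 where n2: "\<forall>n\<ge>n2. norm (fs n b - f b) < \<delta>" using LIMSEQ_D[OF lim \<delta>] by blast
      define n where "n = max N (max n1 n2)"
      have near: "\<bar>fs n a - f a\<bar> < \<delta>" "\<bar>fs n b - f b\<bar> < \<delta>"
        using n1 n2 by (simp_all add: n_def)
      then have near: "fs n a < f a + \<delta>" "f a - \<delta> < fs n a" "fs n b < f b + \<delta>" "f b - \<delta> < fs n b"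
        unfolding abs_less_iff by argo+
      have "\<delta> \<le> (f b - f a) / 4" "\<delta> \<le> e / 4" by (simp_all only: \<delta>_def min.cobounded1 min.cobounded2)
      then have "fs n a < fs n b" using near ab(3) by argo
      then obtain x where x: "x \<in> cont_pts T (fs n)" "x \<in> Iab a b" "fs n a < fs n x" "fs n x < fs n b"
        using sw unfolding swiat_def by blast
      \<comment> \<open>This tolerance keeps the values of \<open>fs n\<close> on \<open>V\<close>
        strictly between \<open>fs n a\<close> and \<open>fs n b\<close>.\<close>
      define \<gamma> where "\<gamma> = min (fs n x - fs n a) (fs n b - fs n x)"
      have "\<gamma> > 0" using x by (simp add: \<gamma>_def)
      then obtain V where V: "openin T V" "x \<in> V" "\<forall>y\<in>V. \<bar>fs n y - fs n x\<bar> < \<gamma>"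
        using x(1) unfolding cont_pts_def by blast
      have I: "Iab a b \<subseteq> ball p r"
        using ab unfolding Iab_def by (auto simp: dist_real_def min_def max_def split: if_splits)
      have "openin T (V \<inter> Iab a b)"
        using V(1) open_imp_openin unfolding Iab_def by (simp add: openin_Int)
      then have "\<not> meager (V \<inter> Iab a b)" using openin_not_meager x V by blast
      \<comment> \<open>A non-meager set is not covered by this meager one, which yields a point of
        \<open>A\<close> in \<open>V\<close> that lies in \<open>E N\<close> as soon as it lies in
        \<open>U\<close>.\<close>
      moreover have "meager (- A \<union> (U - E N))" using A U meager_Un unfolding residual_def by blast
      ultimately obtain y where y: "y \<in> V" "y \<in> Iab a b" "y \<in> A" "y \<notin> U \<or> y \<in> E N"
        using meager_mono[of "- A \<union> (U - E N)" "V \<inter> Iab a b"] by blast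
      then have "y \<in> E N" using I pr by blast
      then have "\<bar>fs n y - f y\<bar> \<le> e / 4" unfolding E_def n_def by simp
      moreover have "fs n a < fs n y" "fs n y < fs n b"
        using V(3) y(1) unfolding \<gamma>_def by force+
      ultimately have "f a - e < f y \<and> f y < f b + e"
        using near \<open>\<delta> \<le> e / 4\<close> e unfolding abs_le_iff by argo
      then show "\<exists>x\<in>A \<inter> Iab a b. f a - e < f x \<and> f x < f b + e" using y by blast
    qed
    \<comment> \<open>The ball is itself one of the intervals whose union is \<open>?G\<close>,
      although it lies in the complement of the closure of \<open>?G\<close>.\<close>
    then have "ball p r \<subseteq> ?G" by (auto simp: ball_eq_greaterThanLessThan)
    then show False using pr W_def closure_subset[of ?G] centre_in_ball by blast
  qed
  then show ?thesis unfolding S_prop_def .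
qed

lemma isCont_imp_cont_pts:
  assumes "isCont g x"
  shows "x \<in> cont_pts T g"
proof -
  have "\<exists>U. openin T U \<and> x \<in> U \<and> (\<forall>y\<in>U. \<bar>g y - g x\<bar> < e)" if e: "e > 0" for e
  proof -
    have "\<forall>\<^sub>F y in nhds x. \<bar>g y - g x\<bar> < e"
      using tendstoD[OF assms[unfolded isCont_def, THEN tendsto_at_iff_tendsto_nhds[THEN iffD1]] e]
      by (simp add: dist_real_def)
    then obtain U where "open U" "x \<in> U" "\<forall>y\<in>U. \<bar>g y - g x\<bar> < e"
      unfolding eventually_nhds by blast
    then show ?thesis using open_imp_openin by blast
  qed
  then show ?thesis unfolding cont_pts_def by blast
qed

end

section \<open>Consequences of the condition S\<close>

text \<open>The preimage of each member of a countable base agrees with an open set up to a meager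
  set. Off the union of these countably many exceptional sets, preimages of open sets are relatively
  open.\<close>

lemma baire_fun_continuous_on_residual:
  assumes f: "baire_fun f"
  obtains M :: "nat \<Rightarrow> real set"
  where "\<And>n. closed (M n)" "\<And>n. nowhere_dense (M n)" "continuous_on (- (\<Union>n. M n)) f"
proof -
  obtain B :: "nat \<Rightarrow> real set"
    where B: "\<And>n. open (B n)" "\<And>S. open S \<Longrightarrow> \<exists>k. S = \<Union>{B n |n. n \<in> k}"
    by (rule univ_second_countable_sequence) blast
  have "\<exists>U. open U \<and> meager (f -` B n - U) \<and> meager (U - f -` B n)" for n
    using f B(1) unfolding baire_fun_def baire_set_iff by blast
  then obtain U where U: "\<And>n. open (U n)" "\<And>n. meager (f -` B n - U n)" "\<And>n. meager (U n - f -` B n)"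
    by metis
  have "meager (\<Union>n. (f -` B n - U n) \<union> (U n - f -` B n))"
    by (intro meager_UN meager_Un U)
  then obtain M :: "nat \<Rightarrow> real set" where M: "\<And>n. closed (M n)" "\<And>n. nowhere_dense (M n)"
    and cover: "(\<Union>n. (f -` B n - U n) \<union> (U n - f -` B n)) \<subseteq> (\<Union>n. M n)"
    by (rule meager_closed_cover) blast
  let ?A = "- (\<Union>n. M n)"
  have eq: "U n \<inter> ?A = f -` B n \<inter> ?A" for n using cover by blast
  have "continuous_on ?A f"
    unfolding continuous_on_open_invariant
  proof (intro allI impI)
    fix V :: "real set" assume "open V"
    then obtain k where k: "V = \<Union>{B n |n. n \<in> k}" using B(2) by blast
    have "(\<Union>n\<in>k. U n) \<inter> ?A = f -` V \<inter> ?A" unfolding k using eq by blast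
    moreover have "open (\<Union>n\<in>k. U n)" using U(1) by (rule open_UN[OF ballI])
    ultimately show "\<exists>W. open W \<and> W \<inter> ?A = f -` V \<inter> ?A" by (intro exI conjI)
  qed
  then show thesis using that M by blast
qed

lemma S_int_subset: "S_int J A e f \<Longrightarrow> J' \<subseteq> J \<Longrightarrow> S_int J' A e f"
  unfolding S_int_def by (meson subsetD)

text \<open>Near a point of \<open>A\<close>, continuity on \<open>A\<close> makes the oscillation
  small, and density puts an interval satisfying S there; hence every nonempty open set contains a
  nonempty good set. On a good set, S yields one point of \<open>A\<close> between \<open>a\<close>
  and \<open>b\<close> whose value is \<open>e\<close>-close to the interval between
  \<open>f a\<close> and \<open>f b\<close>; the oscillation bound carries this to every
  \<open>y\<close> at the cost of a second \<open>e\<close>.\<close>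

lemma S_prop_imp_closed_nowhere_dense:
  assumes A: "residual A" and f: "continuous_on A f" and S: "S_prop A e f" and e: "e > 0"
  obtains F where "closed F" "nowhere_dense F"
    "\<And>a b y. a < b \<Longrightarrow> {a..b} \<inter> F = {} \<Longrightarrow> f a \<noteq> f b \<Longrightarrow> y \<in> A \<Longrightarrow> a < y \<Longrightarrow> y < b \<Longrightarrow>
       min (f a) (f b) - 2 * e < f y \<and> f y < max (f a) (f b) + 2 * e"
proof -
  define good where "good J \<longleftrightarrow> open J \<and> S_int J A e f \<and> (\<forall>y\<in>A\<inter>J. \<forall>z\<in>A\<inter>J. \<bar>f y - f z\<bar> < e)" for J
  have ex_good: "\<exists>J. good J \<and> J \<noteq> {} \<and> J \<subseteq> W" if W: "open W" "W \<noteq> {}" for W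
  proof -
    obtain x where x: "x \<in> A" "x \<in> W" using residual_dense[OF A W] by blast
    have "open (ball (f x) (e / 2))" by simp
    then obtain V where V: "open V" "V \<inter> A = f -` ball (f x) (e / 2) \<inter> A"
      using f unfolding continuous_on_open_invariant by blast
    have "x \<in> V" using V(2) x e by auto
    let ?G = "\<Union>{J. (\<exists>c d. J = {c<..<d}) \<and> S_int J A e f}"
    have "V \<inter> W \<inter> ?G \<noteq> {}"
      using S \<open>x \<in> V\<close> x V(1) W(1) open_Int_closure_eq_empty[of "V \<inter> W" ?G]
      unfolding S_prop_def by auto
    then obtain c d where cd: "S_int {c<..<d} A e f" "V \<inter> W \<inter> {c<..<d} \<noteq> {}" by blast
    have "\<bar>f y - f z\<bar> < e" if "y \<in> A \<inter> V" "z \<in> A \<inter> V" for y z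
    proof -
      have "y \<in> f -` ball (f x) (e / 2)" "z \<in> f -` ball (f x) (e / 2)" using V(2) that by blast+
      then have "\<bar>f x - f y\<bar> < e / 2" "\<bar>f x - f z\<bar> < e / 2" by (simp_all add: dist_real_def)
      then show ?thesis unfolding abs_less_iff by argo
    qed
    then have "good (V \<inter> W \<inter> {c<..<d})"
      unfolding good_def using V(1) W(1) S_int_subset[OF cd(1)] by (auto simp: open_Int)
    then show ?thesis using cd(2) by blast
  qed
  \<comment> \<open>An interval covered by disjoint open sets lies in one of them, so it suffices to take for \<open>F\<close>
    the complement of the union of a maximal disjoint family of good open sets.\<close>
  let ?S = "{\<J>. \<J> \<subseteq> Collect good \<and> pairwise disjnt \<J>}"
  have "\<exists>\<J>\<in>?S. \<forall>X\<in>?S. \<J> \<subseteq> X \<longrightarrow> X = \<J>"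
  proof (rule subset_Zorn')
    fix C assume C: "subset.chain ?S C"
    have "pairwise disjnt (\<Union>C)"
      unfolding pairwise_def
    proof (intro ballI impI)
      fix I J assume "I \<in> \<Union>C" "J \<in> \<Union>C" "I \<noteq> J"
      then obtain X Y where "X \<in> C" "Y \<in> C" "I \<in> X" "J \<in> Y" by blast
      moreover from this have "X \<subseteq> Y \<or> Y \<subseteq> X" using C unfolding subset_chain_def by blast
      ultimately obtain Z where "Z \<in> C" "I \<in> Z" "J \<in> Z" by blast
      then show "disjnt I J"
        using C \<open>I \<noteq> J\<close> unfolding subset_chain_def pairwise_def by blast
    qed
    then show "\<Union>C \<in> ?S"
      using C unfolding subset_chain_def by blast
  qed
  then obtain \<J> where \<J>: "\<J> \<in> ?S" and max: "\<forall>X\<in>?S. \<J> \<subseteq> X \<longrightarrow> X = \<J>"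
    by (rule bexE)
  have max: "X = \<J>" if "X \<subseteq> Collect good" "pairwise disjnt X" "\<J> \<subseteq> X" for X
    using max that by simp
  have \<J>: "\<J> \<subseteq> Collect good" "pairwise disjnt \<J>" using \<J> by simp_all
  have op: "open J" if "J \<in> \<J>" for J using that \<J>(1) good_def by auto
  \<comment> \<open>Otherwise a nonempty good set would fit into this interior and could be added to
    the maximal family.\<close>
  have "interior (- \<Union>\<J>) = {}"
  proof (rule ccontr)
    assume "interior (- \<Union>\<J>) \<noteq> {}"
    then obtain J where J: "good J" "J \<noteq> {}" "J \<subseteq> interior (- \<Union>\<J>)"
      using ex_good[OF open_interior] by blast
    then have dis: "J \<inter> \<Union>\<J> = {}" using interior_subset by blast
    then have "pairwise disjnt (insert J \<J>)"
      using \<J>(2) by (auto simp: pairwise_insert disjnt_def)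
    then have "J \<in> \<J>" using max[of "insert J \<J>"] J(1) \<J>(1) by blast
    then show False using dis J(2) by blast
  qed
  moreover have "closed (- \<Union>\<J>)" using op by (simp add: open_Union closed_Compl)
  moreover have "min (f a) (f b) - 2 * e < f y \<and> f y < max (f a) (f b) + 2 * e"
    if ab: "a < b" "{a..b} \<inter> - \<Union>\<J> = {}" "f a \<noteq> f b" and y: "y \<in> A" "a < y" "y < b" for a b y
  proof -
    have sub: "{a..b} \<subseteq> \<Union>\<J>" using ab(2) by blast
    then obtain J where J: "J \<in> \<J>" "a \<in> J" using ab(1) by force
    define V where "V = \<Union>(\<J> - {J})"
    have "open V" unfolding V_def using op by blast
    moreover have "J \<inter> V \<inter> {a..b} = {}"
      using \<J>(2) J(1) unfolding V_def pairwise_def disjnt_def by blast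
    moreover have sub: "{a..b} \<subseteq> J \<union> V" using sub unfolding V_def by blast
    ultimately have "J \<inter> {a..b} = {} \<or> V \<inter> {a..b} = {}"
      using connectedD[where A = "{a..b}" and U = J and V = V] op[OF J(1)] connected_Icc by blast
    then have sub: "{a..b} \<subseteq> J" using J ab(1) sub by force
    have good: "S_int J A e f" "\<And>y z. y \<in> A \<inter> J \<Longrightarrow> z \<in> A \<inter> J \<Longrightarrow> \<bar>f y - f z\<bar> < e"
      using J(1) \<J>(1) unfolding good_def by auto
    have Iab: "Iab a b = {a<..<b}" "Iab b a = {a<..<b}" using ab(1) by (auto simp: Iab_def)
    have "a \<in> J" "b \<in> J" "y \<in> J" using sub ab(1) y by auto
    have "\<exists>x\<in>A \<inter> {a<..<b}. min (f a) (f b) - e < f x \<and> f x < max (f a) (f b) + e"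
    proof (cases "f a < f b")
      case True
      then have "\<exists>x\<in>A \<inter> Iab a b. f a - e < f x \<and> f x < f b + e"
        using good(1) \<open>a \<in> J\<close> \<open>b \<in> J\<close> unfolding S_int_def by blast
      then show ?thesis using True Iab by (simp add: min_def max_def)
    next
      case False
      then have *: "f b < f a" using ab(3) by simp
      then have "\<exists>x\<in>A \<inter> Iab b a. f b - e < f x \<and> f x < f a + e"
        using good(1) \<open>a \<in> J\<close> \<open>b \<in> J\<close> unfolding S_int_def by blast
      then show ?thesis using * Iab by (simp add: min_def max_def)
    qed
    then obtain x where "x \<in> A" "x \<in> {a<..<b}"
      "min (f a) (f b) - e < f x" "f x < max (f a) (f b) + e" by blast
    moreover from this have "x \<in> J" using sub by auto
    ultimately have "\<bar>f y - f x\<bar> < e" "min (f a) (f b) - e < f x" "f x < max (f a) (f b) + e"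
      using good(2)[of y x] y(1) \<open>y \<in> J\<close> by auto
    then show ?thesis unfolding abs_less_iff by argo
  qed
  ultimately show thesis
    using that[of "- \<Union>\<J>"] unfolding nowhere_dense_def by (simp add: closure_closed)
qed

section \<open>Oscillating extensions from a closed set\<close>

lemma t_sin_t_hits:
  fixes s T :: real
  obtains t where "t > T" "t * sin t = s"
proof -
  obtain k :: nat where k: "\<bar>T\<bar> + \<bar>s\<bar> \<le> real k" using real_arch_simple by blast
  \<comment> \<open>A multiple of the period, so large that on the shifted period the swings of
    \<open>t * sin t\<close> reach beyond \<open>s\<close> on both sides and the argument exceeds
    \<open>T\<close>.\<close>
  define P where "P = 2 * real k * pi"
  define h where "h \<theta> = (\<theta> + P) * sin \<theta>" for \<theta>
  have "real k * 1 \<le> real k * (2 * pi)" using pi_ge_two by (intro mult_left_mono) auto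
  then have pos: "\<bar>T\<bar> + \<bar>s\<bar> \<le> P" using k by (simp add: P_def mult.assoc mult.left_commute)
  have "h (3 / 2 * pi) = - (3 / 2 * pi + P)" "h (pi / 2) = pi / 2 + P"
    unfolding h_def sin_3over2_pi sin_pi_half by simp_all
  then have "h (3 / 2 * pi) \<le> s" "s \<le> h (pi / 2)"
    using pos pi_gt_zero abs_ge_self[of s] abs_ge_minus_self[of s] abs_ge_zero[of T] by argo+
  moreover have "continuous_on {pi / 2..3 / 2 * pi} h" unfolding h_def by (intro continuous_intros)
  moreover have "pi / 2 \<le> 3 / 2 * pi" using pi_gt_zero by argo
  ultimately obtain \<theta> where \<theta>: "\<theta> \<ge> pi / 2" "h \<theta> = s"
    using IVT2'[of h "3 / 2 * pi" s "pi / 2"] by blast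
  have "T < \<theta> + P"
    using \<theta>(1) pos pi_gt_zero abs_ge_self[of T] abs_ge_zero[of s] by argo
  moreover have "sin (\<theta> + P) = sin \<theta>" by (simp add: P_def sin_add)
  then have "(\<theta> + P) * sin (\<theta> + P) = s" using \<theta>(2) by (simp add: h_def)
  ultimately show thesis by (rule that)
qed

text \<open>\<open>f\<close> is kept on \<open>K\<close>. On each component of the complement
  \<open>w\<close> is the centre of the range of the new function and \<open>q\<close> the
  reciprocal of its radius. \<open>K\<close> is nonempty so that \<open>infdist\<close> is a genuine
  distance, positive off \<open>K\<close>.\<close>

locale oscillating_extension =
  fixes K :: "real set" and f w q :: "real \<Rightarrow> real"
  assumes closed_K: "closed K" and K_nonempty: "K \<noteq> {}"
    and w_const: "\<And>x y. y \<in> connected_component_set (- K) x \<Longrightarrow> w y = w x"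
    and q_const: "\<And>x y. y \<in> connected_component_set (- K) x \<Longrightarrow> q y = q x"
    and q_nonneg: "\<And>x. 0 \<le> q x"
begin

text \<open>This is \<open>t * sin t\<close> at the reciprocal \<open>t\<close> of the distance to
  \<open>K\<close>, so on any approach to \<open>K\<close> it takes every real value arbitrarily
  close to \<open>K\<close>.\<close>

definition osc :: "real \<Rightarrow> real" where
  "osc x = 1 / infdist x K * sin (1 / infdist x K)"

text \<open>The map \<open>s \<mapsto> w + s / (1 + q * \<bar>s\<bar>)\<close> takes the line onto \<open>{p. q * \<bar>p - w\<bar> < 1}\<close>;
  in particular the range is unbounded for \<open>q = 0\<close>.\<close>

definition ext :: "real \<Rightarrow> real" where
  "ext x = (if x \<in> K then f x else w x + osc x / (1 + q x * \<bar>osc x\<bar>))"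

lemma denom_pos: "0 < 1 + q x * \<bar>s\<bar>"
  using q_nonneg[of x] by (simp add: add_pos_nonneg)

lemma infdist_pos: "x \<notin> K \<Longrightarrow> 0 < infdist x K"
  using infdist_pos_not_in_closed[OF closed_K K_nonempty] .

lemma isCont_ext:
  assumes x: "x \<notin> K"
  shows "isCont ext x"
proof -
  let ?C = "connected_component_set (- K) x"
  have C: "open ?C" "x \<in> ?C"
    using x closed_K by (auto intro: open_connected_component)
  have "isCont osc x"
    unfolding osc_def using infdist_pos[OF x] by (intro continuous_intros) auto
  then have "isCont (\<lambda>y. w x + osc y / (1 + q x * \<bar>osc y\<bar>)) x"
    using denom_pos[of x "osc x"] by (intro continuous_intros) auto
  moreover have "eventually (\<lambda>y. ext y = w x + osc y / (1 + q x * \<bar>osc y\<bar>)) (nhds x)"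
    using eventually_nhds_in_open[OF C]
  proof eventually_elim
    case (elim y)
    then have "y \<notin> K" using connected_component_subset by blast
    then show ?case using w_const[OF elim] q_const[OF elim] by (simp add: ext_def)
  qed
  ultimately show ?thesis using isCont_cong by fast
qed

lemma ext_range:
  assumes "x \<notin> K"
  shows "q x * \<bar>ext x - w x\<bar> < 1"
proof -
  have "\<bar>ext x - w x\<bar> = \<bar>osc x\<bar> / (1 + q x * \<bar>osc x\<bar>)"
    using assms denom_pos[of x "osc x"] by (simp add: ext_def)
  then show ?thesis using denom_pos[of x "osc x"] by (simp add: pos_divide_less_eq)
qed

text \<open>On the way from \<open>a\<close> to the first point of \<open>K\<close> towards
  \<open>d\<close>, the distance to \<open>K\<close> sinks continuously to 0 and passes through
  every small positive value, among them one where the oscillation produces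
  \<open>p\<close>.\<close>

lemma ext_hits:
  assumes a: "a \<notin> K" and d: "d \<in> K" and p: "q a * \<bar>p - w a\<bar> < 1"
  obtains x where "x \<in> Iab a d" "x \<in> connected_component_set (- K) a" "ext x = p"
proof -
  \<comment> \<open>The point of \<open>K\<close> on the segment nearest to \<open>a\<close>;
    everything before it stays in the component of \<open>a\<close>.\<close>
  obtain d' where d': "d' \<in> K \<inter> closed_segment a d"
    and near: "\<And>y. y \<in> K \<inter> closed_segment a d \<Longrightarrow> dist a d' \<le> dist a y"
    using distance_attains_inf[of "K \<inter> closed_segment a d" a] d closed_K
    by (auto simp: closed_Int)
  define v where "v = p - w a"
  \<comment> \<open>The preimage of \<open>v\<close> under the map that sends \<open>s\<close> to
    \<open>s / (1 + q a * \<bar>s\<bar>)\<close>.\<close>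
  define s where "s = v / (1 - q a * \<bar>v\<bar>)"
  \<comment> \<open>The lower bound on \<open>t\<close> makes the distance \<open>1 / t\<close>
    smaller than that of \<open>a\<close>, so it is attained between \<open>a\<close> and
    \<open>d'\<close>.\<close>
  obtain t where t: "t > 1 / infdist a K" "t * sin t = s" by (rule t_sin_t_hits)
  have "0 < 1 / infdist a K" using infdist_pos[OF a] by simp
  then have t0: "0 < t" using t(1) by (rule order_less_trans)
  then have lt: "1 / t < infdist a K" using t(1) infdist_pos[OF a] by (simp add: field_simps)
  have "connected ((\<lambda>x. infdist x K) ` closed_segment a d')"
    by (intro connected_continuous_image continuous_intros) simp
  moreover have "infdist a K \<in> (\<lambda>x. infdist x K) ` closed_segment a d'" by blast
  moreover have "infdist d' K = 0" using d' by simp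
  then have "0 \<in> (\<lambda>x. infdist x K) ` closed_segment a d'"
    by (metis ends_in_segment(2) imageI)
  ultimately have "{0..infdist a K} \<subseteq> (\<lambda>x. infdist x K) ` closed_segment a d'"
    using connected_contains_Icc by blast
  moreover have "1 / t \<in> {0..infdist a K}" using lt t0 by simp
  ultimately have "1 / t \<in> (\<lambda>x. infdist x K) ` closed_segment a d'" by blast
  then obtain x where x: "x \<in> closed_segment a d'" "infdist x K = 1 / t" by auto
  have xK: "x \<notin> K" using x(2) t0 by auto
  have "x \<noteq> d'" "x \<noteq> a" using xK d' x(2) lt by auto
  then have I: "x \<in> Iab a d"
    using x(1) d' by (auto simp: Iab_def closed_segment_eq_real_ivl split: if_splits)
  have "closed_segment a x \<subseteq> - K"
  proof
    fix y assume y: "y \<in> closed_segment a x"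
    show "y \<in> - K"
    proof
      assume "y \<in> K"
      moreover have "y \<in> closed_segment a d" "dist a y < dist a d'"
        using y x(1) \<open>x \<noteq> d'\<close> d'
        by (auto simp: closed_segment_eq_real_ivl dist_real_def split: if_splits)
      ultimately show False using near[of y] by simp
    qed
  qed
  then have C: "x \<in> connected_component_set (- K) a"
    using connected_component_maximal[of a "closed_segment a x" "- K"] by auto
  have "osc x = s" using t(2) x(2) by (simp add: osc_def)
  have q: "0 < 1 - q a * \<bar>v\<bar>" using p by (simp add: v_def)
  then have "1 + q a * \<bar>s\<bar> = 1 / (1 - q a * \<bar>v\<bar>)" by (simp add: s_def field_simps)
  then have "s / (1 + q a * \<bar>s\<bar>) = v" using q by (simp add: s_def)
  then have "ext x = p"
    using xK \<open>osc x = s\<close> w_const[OF C] q_const[OF C] by (simp add: ext_def v_def)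
  then show thesis using that I C by blast
qed

text \<open>Only two endpoints in \<open>K\<close> call for the assumption \<open>gaps\<close>. From
  an endpoint off \<open>K\<close>, either \<open>K\<close> is not met and the intermediate value
  theorem applies, or the oscillation before \<open>K\<close> takes a value slightly shifted from
  that endpoint's value towards the other one.\<close>

lemma ext_intermediate:
  assumes gaps: "\<And>a b. a \<in> K \<Longrightarrow> b \<in> K \<Longrightarrow> a < b \<Longrightarrow> f a \<noteq> f b \<Longrightarrow>
      \<exists>y p. y \<in> {a<..<b} - K \<and> min (f a) (f b) < p \<and> p < max (f a) (f b) \<and> q y * \<bar>p - w y\<bar> < 1"
    and ab: "ext a \<noteq> ext b"
  shows "\<exists>x\<in>Iab a b. isCont ext x \<and> min (ext a) (ext b) < ext x \<and> ext x < max (ext a) (ext b)"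
proof -
  have off: "\<exists>x\<in>Iab a b. isCont ext x \<and> min (ext a) (ext b) < ext x \<and> ext x < max (ext a) (ext b)"
    if a: "a \<notin> K" and ab: "ext a \<noteq> ext b" for a b
  proof (cases "closed_segment a b \<inter> K = {}")
    case True
    then have "continuous_on (closed_segment a b) ext"
      using isCont_ext by (intro continuous_at_imp_continuous_on) blast
    then have "connected (ext ` closed_segment a b)" by (intro connected_continuous_image) auto
    then have "{min (ext a) (ext b)..max (ext a) (ext b)} \<subseteq> ext ` closed_segment a b"
      by (intro connected_contains_Icc) (auto simp: min_def max_def)
    moreover have "(ext a + ext b) / 2 \<in> {min (ext a) (ext b)..max (ext a) (ext b)}"
      by (auto simp: min_def max_def)
    ultimately have "(ext a + ext b) / 2 \<in> ext ` closed_segment a b" by blast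
    then obtain x where x: "x \<in> closed_segment a b" "ext x = (ext a + ext b) / 2" by force
    then have "x \<noteq> a" "x \<noteq> b" using ab by auto
    then have "x \<in> Iab a b"
      using x(1) by (auto simp: Iab_def closed_segment_eq_real_ivl split: if_splits)
    then show ?thesis using x True isCont_ext ab by (intro bexI[of _ x]) auto
  next
    case False
    then obtain d where d: "d \<in> K" "d \<in> closed_segment a b" by blast
    have "\<exists>p. min (ext a) (ext b) < p \<and> p < max (ext a) (ext b) \<and> q a * \<bar>p - w a\<bar> < 1"
    proof -
      have "continuous_on UNIV (\<lambda>p. q a * \<bar>p - w a\<bar>)" by (intro continuous_intros)
      then have "open {p. q a * \<bar>p - w a\<bar> < 1}" by (intro open_Collect_less) auto
      then obtain r where r: "r > 0" "ball (ext a) r \<subseteq> {p. q a * \<bar>p - w a\<bar> < 1}"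
        using ext_range[OF a] open_contains_ball by blast
      \<comment> \<open>Halving makes both bounds strict: the shifted value stays within the range
        of the component of \<open>a\<close> and does not reach \<open>ext b\<close>.\<close>
      define h where "h = min (r / 2) (\<bar>ext b - ext a\<bar> / 2)"
      have h: "0 < h" "h < r" "h < \<bar>ext b - ext a\<bar>" using r(1) ab by (auto simp: h_def min_def)
      define p where "p = ext a + (if ext a < ext b then h else - h)"
      have "p \<in> ball (ext a) r" using h by (auto simp: p_def dist_real_def)
      then have "q a * \<bar>p - w a\<bar> < 1" using r(2) by blast
      moreover have "min (ext a) (ext b) < p" "p < max (ext a) (ext b)"
        using h ab by (auto simp: p_def)
      ultimately show ?thesis by blast
    qed
    then obtain p where p: "min (ext a) (ext b) < p" "p < max (ext a) (ext b)" "q a * \<bar>p - w a\<bar> < 1"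
      by blast
    obtain x where x: "x \<in> Iab a d" "x \<in> connected_component_set (- K) a" "ext x = p"
      by (rule ext_hits[OF a d(1) p(3)])
    have "x \<in> Iab a b"
      using x(1) d(2) by (auto simp: Iab_def closed_segment_eq_real_ivl split: if_splits)
    moreover have "x \<notin> K" using x(2) connected_component_subset by blast
    ultimately show ?thesis using p x(3) isCont_ext by blast
  qed
  have both: "\<exists>x\<in>Iab a b. isCont ext x \<and> min (ext a) (ext b) < ext x \<and> ext x < max (ext a) (ext b)"
    if ab: "a \<in> K" "b \<in> K" "a < b" "ext a \<noteq> ext b" for a b
  proof -
    have eq: "ext a = f a" "ext b = f b" using ab by (auto simp: ext_def)
    obtain y p where y: "y \<in> {a<..<b}" "y \<notin> K"
      and p: "min (f a) (f b) < p" "p < max (f a) (f b)" "q y * \<bar>p - w y\<bar> < 1"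
      using gaps[OF ab(1-3)] ab(4) eq by auto
    \<comment> \<open>Since \<open>b\<close> lies in \<open>K\<close>, the oscillation on the
      component of \<open>y\<close> takes the value \<open>p\<close> before
      \<open>b\<close>.\<close>
    obtain x where x: "x \<in> Iab y b" "x \<in> connected_component_set (- K) y" "ext x = p"
      by (rule ext_hits[OF y(2) ab(2) p(3)])
    have "x \<in> Iab a b" using x(1) y(1) by (auto simp: Iab_def)
    moreover have "x \<notin> K" using x(2) connected_component_subset by blast
    ultimately show ?thesis using p x(3) eq isCont_ext by auto
  qed
  have Iab_commute: "Iab b a = Iab a b" by (simp add: Iab_def min.commute max.commute)
  consider "a \<notin> K" | "b \<notin> K" | "a \<in> K" "b \<in> K" "a < b" | "a \<in> K" "b \<in> K" "b < a"
    using ab by fastforce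
  then show ?thesis
  proof cases
    case 1 then show ?thesis using off ab by blast
  next
    case 2 then show ?thesis
      using off[of b a] ab unfolding Iab_commute by (simp add: min.commute max.commute)
  next
    case 3 then show ?thesis using both ab by blast
  next
    case 4 then show ?thesis
      using both[of b a] ab unfolding Iab_commute by (simp add: min.commute max.commute)
  qed
qed

end

section \<open>Approximation by Swiatkowski functions\<close>

lemma closed_countable_imp_nowhere_dense:
  assumes "closed S" "countable S"
  shows "nowhere_dense S"
proof -
  have "interior S = {}"
  proof (rule ccontr)
    assume "interior S \<noteq> {}"
    then obtain x r where "r > 0" "ball x r \<subseteq> S"
      using mem_interior by blast
    then show False using assms(2) uncountable_ball countable_subset by blast
  qed
  then show ?thesis using assms(1) by (simp add: nowhere_dense_def closure_closed)
qed

definition grid :: "nat \<Rightarrow> real set" where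
  "grid n = range (\<lambda>k::int. of_int k / (real n + 1))"

lemma closed_grid: "closed (grid n)"
proof -
  have "closed ((\<lambda>x. (1 / (real n + 1)) *\<^sub>R x) ` (of_int ` (UNIV :: int set) :: real set))"
    by (rule closed_scaling[OF closed_of_int_image])
  then show ?thesis by (simp add: grid_def image_image)
qed

lemma nowhere_dense_grid: "nowhere_dense (grid n)"
  by (rule closed_countable_imp_nowhere_dense[OF closed_grid]) (simp add: grid_def)

lemma grid_gap:
  assumes "x < y" "{x..y} \<inter> grid n = {}"
  shows "y - x < 1 / (real n + 1)"
proof (rule ccontr)
  let ?N = "real n + 1"
  assume "\<not> ?thesis"
  then have "1 \<le> (y - x) * ?N" by (simp add: field_simps)
  then have *: "x * ?N + 1 \<le> y * ?N" by (simp add: left_diff_distrib)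
  define k where "k = \<lceil>x * ?N\<rceil>"
  have "x * ?N \<le> of_int k" "of_int k < x * ?N + 1"
    using ceiling_correct[of "x * ?N"] by (simp_all add: k_def)
  then have "x * ?N \<le> of_int k" "of_int k \<le> y * ?N" using * by simp_all
  then have "of_int k / ?N \<in> {x..y}" by (simp add: pos_le_divide_eq pos_divide_le_eq)
  then show False using assms(2) unfolding grid_def by blast
qed

text \<open>A component is an interval free of grid points, hence shorter than the mesh allows. This
  forces the centres chosen in components around a fixed point to converge to it.\<close>

lemma component_grid_small:
  assumes "grid n \<subseteq> K" "y \<in> connected_component_set (- K) x"
  shows "\<bar>y - x\<bar> < 1 / (real n + 1)"
proof -
  let ?C = "connected_component_set (- K) x"
  have x: "x \<in> ?C" using assms(2) connected_component_in by fastforce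
  have C: "?C \<inter> grid n = {}" using assms(1) connected_component_subset[of "- K" x] by blast
  have sub: "{a..b} \<subseteq> ?C" if "a \<in> ?C" "b \<in> ?C" for a b
    using connected_contains_Icc[OF connected_connected_component that] .
  consider "x < y" | "y < x" | "x = y" by linarith
  then show ?thesis
  proof cases
    case 1
    then have "y - x < 1 / (real n + 1)" using grid_gap[of x y n] sub[OF x assms(2)] C by blast
    then show ?thesis using 1 by simp
  next
    case 2
    then have "x - y < 1 / (real n + 1)" using grid_gap[of y x n] sub[OF assms(2) x] C by blast
    then show ?thesis using 2 by simp
  qed simp
qed

lemma closed_nowhere_dense_UN_atMost:
  fixes N :: "nat \<Rightarrow> real set"
  assumes "\<And>i. closed (N i)" "\<And>i. nowhere_dense (N i)"
  shows "closed (\<Union>i\<le>n. N i)" "nowhere_dense (\<Union>i\<le>n. N i)"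
proof -
  show "closed (\<Union>i\<le>n. N i)" using assms by (intro closed_UN) auto
  show "nowhere_dense (\<Union>i\<le>n. N i)"
  proof (induction n)
    case 0 then show ?case using assms by simp
  next
    case (Suc n) then show ?case using assms nowhere_dense_Un by (simp add: atMost_Suc)
  qed
qed

lemma nowhere_dense_open_Diff:
  assumes "closed K" "nowhere_dense K" "open W" "W \<noteq> {}"
  obtains y where "y \<in> W" "y \<notin> K"
proof -
  have "\<not> W \<subseteq> K"
    using assms interior_maximal[of W K] unfolding nowhere_dense_def by (auto simp: closure_closed)
  then show thesis using that by blast
qed

text \<open>The open intervals from \<open>u\<close> to \<open>v\<close> and from
  \<open>w - d\<close> to \<open>w + d\<close> overlap.\<close>

lemma ex_value_near:
  fixes u v w d :: real
  assumes "u < v" "0 < d" "u - d < w" "w < v + d"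
  obtains p where "u < p" "p < v" "\<bar>p - w\<bar> < d"
proof -
  have "max u (w - d) < min v (w + d)" using assms by (simp add: algebra_simps)
  then obtain p where "max u (w - d) < p" "p < min v (w + d)" using dense by blast
  then show thesis by (intro that[of p]) (simp_all add: abs_less_iff)
qed

locale swiat_approximation =
  fixes f :: "real \<Rightarrow> real" and M F :: "nat \<Rightarrow> real set" and A :: "real set"
  assumes closed_M: "\<And>i. closed (M i)" and nowhere_dense_M: "\<And>i. nowhere_dense (M i)"
    and A_def: "A = - (\<Union>i. M i)"
    and cont_A: "continuous_on A f"
    and closed_F: "\<And>i. closed (F i)" and nowhere_dense_F: "\<And>i. nowhere_dense (F i)"
    and F_gap: "\<And>m a b y. a < b \<Longrightarrow> {a..b} \<inter> F m = {} \<Longrightarrow> f a \<noteq> f b \<Longrightarrow> y \<in> A \<Longrightarrow> a < y \<Longrightarrow> y < b \<Longrightarrow>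
        min (f a) (f b) - 1 / (real m + 1) < f y \<and> f y < max (f a) (f b) + 1 / (real m + 1)"
begin

definition K :: "nat \<Rightarrow> real set" where
  "K n = grid n \<union> (\<Union>i\<le>n. F i \<union> M i)"

abbreviation comp :: "nat \<Rightarrow> real \<Rightarrow> real set" where
  "comp n x \<equiv> connected_component_set (- K n) x"

text \<open>The choice depends on \<open>x\<close> only through its component, so it is constant on
  components.\<close>

definition base :: "nat \<Rightarrow> real \<Rightarrow> real" where
  "base n x = (SOME y. y \<in> A \<and> y \<in> comp n x)"

text \<open>The level is the reciprocal of the radius, and level 0 stands for an unbounded range.
  The alternative \<open>n < m\<close> guarantees that the minimum exists and caps it at
  \<open>n + 1\<close>.\<close>

definition level :: "nat \<Rightarrow> real \<Rightarrow> nat" where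
  "level n x = (LEAST m. n < m \<or> (\<exists>z\<in>F m. \<exists>y\<in>comp n x. \<bar>y - z\<bar> < 1 / (real n + 1)))"

lemma closed_K: "closed (K n)"
  unfolding K_def using closed_F closed_M
  by (intro closed_Un closed_grid closed_nowhere_dense_UN_atMost nowhere_dense_Un
      nowhere_dense_F nowhere_dense_M) auto

lemma nowhere_dense_K: "nowhere_dense (K n)"
  unfolding K_def
  by (intro nowhere_dense_Un nowhere_dense_grid closed_nowhere_dense_UN_atMost closed_Un
      closed_F closed_M nowhere_dense_F nowhere_dense_M)

lemma residual_A: "residual A"
  unfolding residual_def A_def by (simp add: meager_UN nowhere_dense_imp_meager nowhere_dense_M)

lemma base:
  assumes "x \<notin> K n"
  shows "base n x \<in> A" "base n x \<in> comp n x"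
proof -
  have "open (comp n x)" "x \<in> comp n x"
    using assms closed_K by (auto intro: open_connected_component)
  then have "\<exists>y. y \<in> A \<and> y \<in> comp n x" using residual_dense[OF residual_A, of "comp n x"] by blast
  then have "base n x \<in> A \<and> base n x \<in> comp n x" unfolding base_def by (rule someI_ex)
  then show "base n x \<in> A" "base n x \<in> comp n x" by auto
qed

lemma comp_small: "y \<in> comp n x \<Longrightarrow> \<bar>y - x\<bar> < 1 / (real n + 1)"
  by (rule component_grid_small[of n "K n"]) (auto simp: K_def)

lemma level: "n < level n x \<or> (\<exists>z\<in>F (level n x). \<exists>y\<in>comp n x. \<bar>y - z\<bar> < 1 / (real n + 1))"
  unfolding level_def by (rule LeastI[of _ "Suc n"]) simp

lemma level_le:
  "n < m \<or> (\<exists>z\<in>F m. \<exists>y\<in>comp n x. \<bar>y - z\<bar> < 1 / (real n + 1)) \<Longrightarrow> level n x \<le> m"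
  unfolding level_def by (rule Least_le)

sublocale oscillating_extension "K n" f "\<lambda>x. f (base n x)" "\<lambda>x. real (level n x)" for n
proof
  show "closed (K n)" by (rule closed_K)
  show "K n \<noteq> {}" by (auto simp: K_def grid_def)
  fix x y assume "y \<in> comp n x"
  then have "comp n y = comp n x" by (metis connected_component_eq)
  then show "f (base n y) = f (base n x)" "real (level n y) = real (level n x)"
    by (simp_all add: base_def level_def)
qed simp

abbreviation approx :: "nat \<Rightarrow> real \<Rightarrow> real" where
  "approx n \<equiv> ext n"

text \<open>This is the hypothesis of \<open>ext_intermediate\<close>. A component between
  \<open>a\<close> and \<open>b\<close> is sought whose radius is large enough to make up for the
  distance of its centre from the interval between \<open>f a\<close> and
  \<open>f b\<close>.\<close>

lemma K_gap:
  assumes ab: "a \<in> K n" "b \<in> K n" "a < b" "f a \<noteq> f b"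
  shows "\<exists>y p. y \<in> {a<..<b} - K n \<and> min (f a) (f b) < p \<and> p < max (f a) (f b) \<and>
    real (level n y) * \<bar>p - f (base n y)\<bar> < 1"
proof -
  \<comment> \<open>By minimality \<open>[a, b]\<close> misses \<open>F (m - 1)\<close> if
    \<open>m\<close> is positive, and this gives control at scale \<open>1 / m\<close>, exactly the
    radius belonging to level \<open>m\<close>.\<close>
  define m where "m = (LEAST m. n < m \<or> F m \<inter> {a..b} \<noteq> {})"
  have m: "n < m \<or> F m \<inter> {a..b} \<noteq> {}"
    unfolding m_def by (rule LeastI[of _ "Suc n"]) simp
  \<comment> \<open>If \<open>m = n + 1\<close>, every level is small enough. Otherwise
    \<open>y\<close> is taken close to a point of \<open>F m\<close> in \<open>[a, b]\<close>,
    possibly an endpoint, hence the closure argument.\<close>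
  obtain y where y: "a < y" "y < b" "y \<notin> K n" "level n y \<le> m"
  proof (cases "n < m")
    case True
    obtain y where "y \<in> {a<..<b}" "y \<notin> K n"
      by (rule nowhere_dense_open_Diff[OF closed_K nowhere_dense_K, of "{a<..<b}" n]) (use ab in auto)
    then show thesis using that level_le True by auto
  next
    case False
    then obtain z where z: "z \<in> F m" "a \<le> z" "z \<le> b" using m by auto
    let ?W = "{a<..<b} \<inter> ball z (1 / (real n + 1))"
    have "z \<in> closure {a<..<b}" using z ab(3) by simp
    then have "?W \<noteq> {}"
      using open_Int_closure_eq_empty[of "ball z (1 / (real n + 1))" "{a<..<b}"] by (auto simp: Int_commute)
    moreover have "open ?W" by (intro open_Int) auto
    ultimately obtain y where y: "y \<in> ?W" "y \<notin> K n"
      using nowhere_dense_open_Diff[OF closed_K nowhere_dense_K] by metis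
    then have "y \<in> comp n y" "\<bar>y - z\<bar> < 1 / (real n + 1)"
      by (simp_all add: dist_real_def abs_minus_commute)
    then have "level n y \<le> m" using z(1) level_le by blast
    then show thesis using that[of y] y by auto
  qed
  \<comment> \<open>A component leaving the interval would contain \<open>a\<close> or
    \<open>b\<close>, which lie in \<open>K n\<close>.\<close>
  have C: "comp n y \<subseteq> {a<..<b}"
  proof
    fix x assume x: "x \<in> comp n y"
    have y': "y \<in> comp n y" using y(3) by simp
    have "{x..y} \<subseteq> - K n" "{y..x} \<subseteq> - K n"
      using connected_contains_Icc[OF connected_connected_component x y']
        connected_contains_Icc[OF connected_connected_component y' x]
        connected_component_subset by blast+
    then show "x \<in> {a<..<b}" using ab y(1,2) by (force simp: not_less subset_iff)
  qed
  have w: "base n y \<in> A" "a < base n y" "base n y < b" using base[OF y(3)] C by auto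
  have lt: "min (f a) (f b) < max (f a) (f b)" using ab(4) by auto
  have "\<exists>p. min (f a) (f b) < p \<and> p < max (f a) (f b) \<and> real m * \<bar>p - f (base n y)\<bar> < 1"
  proof (cases m)
    \<comment> \<open>There is no control on the centre here, but the range at level 0 is the whole
      line.\<close>
    case 0
    then show ?thesis using dense[OF lt] by auto
  next
    case (Suc k)
    then have "\<not> (n < k \<or> F k \<inter> {a..b} \<noteq> {})"
      unfolding m_def by (intro not_less_Least) auto
    then have "{a..b} \<inter> F k = {}" by blast
    then have "min (f a) (f b) - 1 / (real k + 1) < f (base n y)"
      "f (base n y) < max (f a) (f b) + 1 / (real k + 1)"
      using F_gap[OF ab(3) _ ab(4) w] by auto
    then obtain p where "min (f a) (f b) < p" "p < max (f a) (f b)" "\<bar>p - f (base n y)\<bar> < 1 / (real k + 1)"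
      by (rule ex_value_near[OF lt, rotated]) auto
    then show ?thesis using Suc by (auto simp: field_simps intro!: exI[of _ p])
  qed
  then obtain p where p: "min (f a) (f b) < p" "p < max (f a) (f b)" "real m * \<bar>p - f (base n y)\<bar> < 1"
    by blast
  have "real (level n y) * \<bar>p - f (base n y)\<bar> \<le> real m * \<bar>p - f (base n y)\<bar>"
    using y(4) by (intro mult_right_mono) auto
  then show ?thesis using y p by (intro exI[of _ y] exI[of _ p]) auto
qed

lemma approx_intermediate:
  assumes "approx n a \<noteq> approx n b"
  shows "\<exists>x\<in>Iab a b. isCont (approx n) x \<and>
    min (approx n a) (approx n b) < approx n x \<and> approx n x < max (approx n a) (approx n b)"
  by (rule ext_intermediate[OF K_gap assms])

text \<open>A point of some \<open>F i\<close> or \<open>M i\<close> is eventually in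
  \<open>K n\<close>, where the value is exact. At any other point the centres converge by
  continuity on \<open>A\<close>, and the radii tend to 0 because the point has positive distance
  from each closed set \<open>F m\<close>.\<close>

lemma approx_tendsto: "(\<lambda>n. approx n x) \<longlonglongrightarrow> f x"
proof (cases "x \<in> (\<Union>i. F i \<union> M i)")
  case True
  then obtain i where "x \<in> F i \<union> M i" by blast
  then have "x \<in> K n" if "i \<le> n" for n using that unfolding K_def by blast
  then have "\<forall>\<^sub>F n in sequentially. approx n x = f x"
    unfolding eventually_sequentially by (intro exI[of _ i]) (simp add: ext_def)
  then show ?thesis by (rule tendsto_eventually)
next
  case False
  then have xA: "x \<in> A" and xF: "x \<notin> F m" for m unfolding A_def by auto
  show ?thesis
    unfolding tendsto_iff
  proof (intro allI impI)
    fix e :: real assume e: "e > 0"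
    then obtain \<delta> where \<delta>: "\<delta> > 0" "\<And>y. y \<in> A \<Longrightarrow> \<bar>y - x\<bar> < \<delta> \<Longrightarrow> \<bar>f y - f x\<bar> < e / 2"
      using cont_A xA unfolding continuous_on_iff dist_real_def by (meson half_gt_zero)
    obtain L :: nat where L: "1 / (real L + 1) < e / 2"
      using reals_Archimedean[of "e / 2"] e by (auto simp: inverse_eq_divide add.commute)
    have to0: "(\<lambda>n. 1 / (real n + 1)) \<longlonglongrightarrow> 0"
      using LIMSEQ_inverse_real_of_nat by (simp add: inverse_eq_divide add.commute)
    \<comment> \<open>The factor 2 pays once for the distance from \<open>x\<close> to another point
      of its component and once for the distance from there to \<open>F m\<close>. Hence eventually
      none of the levels up to \<open>L\<close> can occur at \<open>x\<close>.\<close>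
    have "\<forall>\<^sub>F n in sequentially. \<forall>z\<in>F m. 2 * (1 / (real n + 1)) < \<bar>x - z\<bar>" for m
    proof -
      obtain r where r: "r > 0" "ball x r \<subseteq> - F m"
        using xF[of m] open_contains_ball[of "- F m"] open_Compl[OF closed_F[of m]] by blast
      have "\<forall>\<^sub>F n in sequentially. 1 / (real n + 1) < r / 2"
        by (rule order_tendstoD(2)[OF to0 half_gt_zero[OF r(1)]])
      then show ?thesis
      proof eventually_elim
        case (elim n)
        then have "2 * (1 / (real n + 1)) < r" by linarith
        moreover have "r \<le> \<bar>x - z\<bar>" if "z \<in> F m" for z
        proof (rule ccontr)
          assume "\<not> ?thesis"
          then have "z \<in> ball x r" by (simp add: dist_real_def)
          then show False using r(2) that by blast
        qed
        ultimately show ?case by (blast intro: order_less_le_trans)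
      qed
    qed
    then have "\<forall>\<^sub>F n in sequentially. \<forall>m\<in>{..L}. \<forall>z\<in>F m. 2 * (1 / (real n + 1)) < \<bar>x - z\<bar>"
      by (intro eventually_ball_finite) auto
    moreover have "\<forall>\<^sub>F n in sequentially. 1 / (real n + 1) < \<delta>"
      using order_tendstoD(2)[OF to0 \<delta>(1)] .
    moreover have "\<forall>\<^sub>F n in sequentially. L \<le> n" by (rule eventually_ge_at_top)
    ultimately show "\<forall>\<^sub>F n in sequentially. dist (approx n x) (f x) < e"
    proof eventually_elim
      case (elim n)
      show ?case
      proof (cases "x \<in> K n")
        case True
        then show ?thesis using e by (simp add: ext_def)
      next
        case False
        have near: "\<bar>f (base n x) - f x\<bar> < e / 2"
          using base[OF False] comp_small elim(2) \<delta>(2) by (meson order_less_trans)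
        have "L < level n x"
        proof (rule ccontr)
          assume *: "\<not> ?thesis"
          then obtain z y where z: "z \<in> F (level n x)" "y \<in> comp n x" "\<bar>y - z\<bar> < 1 / (real n + 1)"
            using level[of n x] elim(3) by auto
          have "2 * (1 / (real n + 1)) < \<bar>x - z\<bar>" using elim(1) z(1) * by (meson atMost_iff not_less)
          then show False using comp_small[OF z(2)] z(3) by argo
        qed
        then have "(real L + 1) * \<bar>approx n x - f (base n x)\<bar>
            \<le> real (level n x) * \<bar>approx n x - f (base n x)\<bar>"
          by (intro mult_right_mono) auto
        also have "\<dots> < 1" by (rule ext_range[OF False])
        finally have "\<bar>approx n x - f (base n x)\<bar> < 1 / (real L + 1)" by (simp add: field_simps)
        then have "\<bar>approx n x - f (base n x)\<bar> < e / 2" using L by (rule order_less_trans)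
        then show ?thesis using near unfolding dist_real_def by argo
      qed
    qed
  qed
qed

end

text \<open>The intermediate points are points of ordinary continuity, which is continuity for every
  topology refining the Euclidean one.\<close>

lemma frakS_approximation:
  assumes "f \<in> frakS"
  obtains fs :: "nat \<Rightarrow> real \<Rightarrow> real"
  where "\<And>n a b. fs n a \<noteq> fs n b \<Longrightarrow> \<exists>x\<in>Iab a b. isCont (fs n) x \<and>
      min (fs n a) (fs n b) < fs n x \<and> fs n x < max (fs n a) (fs n b)"
    "\<And>x. (\<lambda>n. fs n x) \<longlonglongrightarrow> f x"
proof -
  have f: "baire_fun f" "\<And>A e. residual A \<Longrightarrow> e > 0 \<Longrightarrow> S_prop A e f"
    using assms unfolding frakS_def by auto
  obtain M :: "nat \<Rightarrow> real set" where M: "\<And>n. closed (M n)" "\<And>n. nowhere_dense (M n)"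
    "continuous_on (- (\<Union>n. M n)) f"
    using baire_fun_continuous_on_residual[OF f(1)] by blast
  have A: "residual (- (\<Union>n. M n))"
    unfolding residual_def by (simp add: meager_UN nowhere_dense_imp_meager M(2))
  have "\<exists>F. closed F \<and> nowhere_dense F \<and> (\<forall>a b y. a < b \<longrightarrow> {a..b} \<inter> F = {} \<longrightarrow> f a \<noteq> f b \<longrightarrow>
      y \<in> - (\<Union>n. M n) \<longrightarrow> a < y \<longrightarrow> y < b \<longrightarrow>
      min (f a) (f b) - 1 / (real m + 1) < f y \<and> f y < max (f a) (f b) + 1 / (real m + 1))" for m
  proof -
    \<comment> \<open>Half of the desired scale, since the control obtained from S has error
      \<open>2 * e\<close>.\<close>
    define e where "e = 1 / (2 * (real m + 1))"
    have e: "e > 0" "2 * e = 1 / (real m + 1)" by (simp_all add: e_def field_simps)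
    show ?thesis
      by (rule S_prop_imp_closed_nowhere_dense[OF A M(3) f(2)[OF A e(1)] e(1)])
        (unfold e(2), blast)
  qed
  then obtain F where F: "\<forall>m. closed (F m) \<and> nowhere_dense (F m) \<and>
      (\<forall>a b y. a < b \<longrightarrow> {a..b} \<inter> F m = {} \<longrightarrow> f a \<noteq> f b \<longrightarrow>
      y \<in> - (\<Union>n. M n) \<longrightarrow> a < y \<longrightarrow> y < b \<longrightarrow>
      min (f a) (f b) - 1 / (real m + 1) < f y \<and> f y < max (f a) (f b) + 1 / (real m + 1))"
    by metis
  interpret swiat_approximation f M F "- (\<Union>n. M n)"
  proof
    show "min (f a) (f b) - 1 / (real m + 1) < f y \<and> f y < max (f a) (f b) + 1 / (real m + 1)"
      if "a < b" "{a..b} \<inter> F m = {}" "f a \<noteq> f b" "y \<in> - (\<Union>n. M n)" "a < y" "y < b" for m a b y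
      using F that by simp
  qed (simp_all add: M F del: Compl_UN)
  show thesis
    by (rule that[of approx]) (fact approx_intermediate approx_tendsto)+
qed

theorem mainTheorem11:
  fixes T :: "real topology"
  assumes "\<forall>U. open U \<longrightarrow> openin T U"
    and "\<forall>U. openin T U \<and> U \<noteq> {} \<longrightarrow> baire_set U \<and> \<not> meager U"
  shows "{f. \<exists>fs :: nat \<Rightarrow> real \<Rightarrow> real. (\<forall>n. swiat T (fs n)) \<and>
              (\<forall>x. (\<lambda>n. fs n x) \<longlonglongrightarrow> f x)} = frakS"
proof -
  interpret baire_refinement T
    by unfold_locales (use assms in auto)
  show ?thesis
  proof (intro set_eqI iffI)
    fix f assume "f \<in> {f. \<exists>fs :: nat \<Rightarrow> real \<Rightarrow> real. (\<forall>n. swiat T (fs n)) \<and>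
              (\<forall>x. (\<lambda>n. fs n x) \<longlonglongrightarrow> f x)}"
    then obtain fs :: "nat \<Rightarrow> real \<Rightarrow> real"
      where fs: "\<And>n. swiat T (fs n)" "\<And>x. (\<lambda>n. fs n x) \<longlonglongrightarrow> f x" by blast
    have "baire_fun f" by (rule baire_fun_lim[OF swiat_imp_baire_fun[OF fs(1)] fs(2)])
    moreover have "S_prop A e f" if "residual A" "e > 0" for A e
      by (rule swiat_lim_S_prop[OF fs that])
    ultimately show "f \<in> frakS" unfolding frakS_def by blast
  next
    fix f assume "f \<in> frakS"
    then obtain fs :: "nat \<Rightarrow> real \<Rightarrow> real"
      where fs: "\<And>n a b. fs n a \<noteq> fs n b \<Longrightarrow> \<exists>x\<in>Iab a b. isCont (fs n) x \<and>
          min (fs n a) (fs n b) < fs n x \<and> fs n x < max (fs n a) (fs n b)"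
        and lim: "\<And>x. (\<lambda>n. fs n x) \<longlonglongrightarrow> f x"
      by (rule frakS_approximation) blast
    have "swiat T (fs n)" for n
      unfolding swiat_def
    proof (intro allI impI)
      fix a b assume ab: "fs n a < fs n b"
      then obtain x where x: "x \<in> Iab a b" "isCont (fs n) x" "fs n a < fs n x" "fs n x < fs n b"
        using fs[of n a b] by auto
      then show "\<exists>x\<in>cont_pts T (fs n). x \<in> Iab a b \<and> fs n a < fs n x \<and> fs n x < fs n b"
        using isCont_imp_cont_pts by blast
    qed
    then show "f \<in> {f. \<exists>fs :: nat \<Rightarrow> real \<Rightarrow> real. (\<forall>n. swiat T (fs n)) \<and>
              (\<forall>x. (\<lambda>n. fs n x) \<longlonglongrightarrow> f x)}" using lim by blast
  qed
qed

end
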